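(* Let $P=(v_2,v_6,v_1,v_3,v_5)^\top\in\mathbb{R}^5$ satisfy $\eta(v_5,v_6)<1$. Suppose that $\mathcal{A}$ has a critical value $M$, a critical SOS decomposition and a critical minimizer at $P$; that is, suppose there are a number $M\in\mathbb{R}$ and a point $\bar{\mathbf{x}}=(\bar x_1,\bar x_2,\bar x_3,\bar x_4)^\top\in\mathbb{R}^4$ with $\bar x_1^2+\bar x_4^2>0$ such that, for $v_0=M$, the Hankel tensor $\mathcal{A}$ is SOS and its polynomial $f_0$ satisfies $f_0(\bar{\mathbf{x}})=0$. Then $P$ is PNS-free.
   Context: A fourth order four dimensional Hankel tensor $\mathcal{A}=(a_{i_1i_2i_3i_4})$ with generating vector $\mathbf{v}=(v_0,\ldots,v_{12})^\top\in\mathbb{R}^{13}$ is defined by $a_{i_1i_2i_3i_4}=v_{i_1+i_2+i_3+i_4-4}$ for $i_1,i_2,i_3,i_4\in\{1,2,3,4\}$. Its associated polynomial is $f(\mathbf{x})=\sum_{i_1,i_2,i_3,i_4=1}^4 v_{i_1+i_2+i_3+i_4-4}\,x_{i_1}x_{i_2}x_{i_3}x_{i_4}$, $\mathbf{x}\in\mathbb{R}^4$. $\mathcal{A}$ is PSD if $f(\mathbf{x})\ge 0$ for all $\mathbf{x}\in\mathbb{R}^4$; it is SOS if $f$ is a sum of squares of real quadratic homogeneous polynomials. Given $P=(v_2,v_6,v_1,v_3,v_5)^\top\in\mathbb{R}^5$ and $v_0\in\mathbb{R}$, $\mathcal{A}$ denotes the Hankel tensor with generating vector $(v_0,v_1,v_2,v_3,1,v_5,v_6,v_5,1,v_3,v_2,v_1,v_0)^\top$.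 $M_0(P)$ (respectively $N_0(P)$) denotes the smallest $v_0$ for which $\mathcal{A}$ is SOS (respectively PSD), so that $\mathcal{A}$ is SOS iff $v_0\ge M_0(P)$ and PSD iff $v_0\ge N_0(P)$; these exist whenever $\eta(v_5,v_6)<1$. $P$ is called PNS-free if $M_0(P)=N_0(P)$. The function $\eta:\mathbb{R}^2\to\mathbb{R}$ is defined by $\eta(\beta,\gamma)=4|\beta|-3\gamma$ if $\gamma\le|\beta|$, and $\eta(\beta,\gamma)=\frac{3\gamma-\sqrt{9\gamma^2-8\beta^2}}{2}$ if $\gamma>|\beta|$. *)

theory Defs
  imports "HOL-Analysis.Analysis"
begin

text \<open>
  Tensor indices are the naturals 1, ..., 4, as in the usual notation; the coordinate
  \<open>x\<^sub>i\<close> of \<open>x :: real ^ 4\<close> is \<open>x $ of_nat i\<close>.  In the numeral type \<open>4\<close> we have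
  \<open>4 = 0\<close>, so 1, 2, 3, 4 are its four distinct elements.  The same applies to \<open>real ^ 5\<close>.
\<close>

type_synonym tensor4 = "nat \<Rightarrow> nat \<Rightarrow> nat \<Rightarrow> nat \<Rightarrow> real"

text \<open>The generating vector is a list of length 13 with entries numbered from 0 to 12.\<close>

definition hankel_tensor :: "real list \<Rightarrow> tensor4" where
  "hankel_tensor v i1 i2 i3 i4 = v ! (i1 + i2 + i3 + i4 - 4)"

definition tensor_poly :: "tensor4 \<Rightarrow> real ^ 4 \<Rightarrow> real" where
  "tensor_poly A x =
     (\<Sum>i1\<in>{1..4}. \<Sum>i2\<in>{1..4}. \<Sum>i3\<in>{1..4}. \<Sum>i4\<in>{1..4}.
        A i1 i2 i3 i4 * x $ of_nat i1 * x $ of_nat i2 * x $ of_nat i3 * x $ of_nat i4)"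

definition PSD :: "tensor4 \<Rightarrow> bool" where
  "PSD A \<longleftrightarrow> (\<forall>x. tensor_poly A x \<ge> 0)"

text \<open>
  Real polynomials are identified with the functions they induce, which loses nothing
  since the field of real numbers is infinite.
\<close>

definition quadratic_form :: "(real ^ 4 \<Rightarrow> real) \<Rightarrow> bool" where
  "quadratic_form q \<longleftrightarrow>
     (\<exists>c :: nat \<Rightarrow> nat \<Rightarrow> real.
        \<forall>x. q x = (\<Sum>i\<in>{1..4}. \<Sum>j\<in>{1..4}. c i j * x $ of_nat i * x $ of_nat j))"

definition SOS :: "tensor4 \<Rightarrow> bool" where
  "SOS A \<longleftrightarrow>
     (\<exists>(n :: nat) (q :: nat \<Rightarrow> real ^ 4 \<Rightarrow> real).
        (\<forall>k<n. quadratic_form (q k)) \<and>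
        (\<forall>x. tensor_poly A x = (\<Sum>k<n. (q k x)\<^sup>2)))"

text \<open>The parameter vector is \<open>P = (v\<^sub>2, v\<^sub>6, v\<^sub>1, v\<^sub>3, v\<^sub>5)\<close>, in this order.\<close>

definition gen_vector :: "real \<Rightarrow> real ^ 5 \<Rightarrow> real list" where
  "gen_vector v0 P =
     (let v2 = P $ 1; v6 = P $ 2; v1 = P $ 3; v3 = P $ 4; v5 = P $ 5
      in [v0, v1, v2, v3, 1, v5, v6, v5, 1, v3, v2, v1, v0])"

definition hankel :: "real \<Rightarrow> real ^ 5 \<Rightarrow> tensor4" where
  "hankel v0 P = hankel_tensor (gen_vector v0 P)"

definition eta :: "real \<Rightarrow> real \<Rightarrow> real" where
  "eta \<beta> \<gamma> =
     (if \<gamma> \<le> \<bar>\<beta>\<bar> then 4 * \<bar>\<beta>\<bar> - 3 * \<gamma>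
      else (3 * \<gamma> - sqrt (9 * \<gamma>\<^sup>2 - 8 * \<beta>\<^sup>2)) / 2)"

text \<open>
  The minima \<open>M0 P\<close> and \<open>N0 P\<close> exist when \<open>eta (P $ 5) (P $ 2) < 1\<close>; where a minimum does
  not exist, \<open>LEAST\<close> is an unspecified value and \<open>PNS_free P\<close> carries no information.
\<close>

definition M0 :: "real ^ 5 \<Rightarrow> real" where
  "M0 P = (LEAST v0. SOS (hankel v0 P))"

definition N0 :: "real ^ 5 \<Rightarrow> real" where
  "N0 P = (LEAST v0. PSD (hankel v0 P))"

definition PNS_free :: "real ^ 5 \<Rightarrow> bool" where
  "PNS_free P \<longleftrightarrow> M0 P = N0 P"

end

theory Submission
  imports Defs
begin

text \<open>\<open>v0\<close> stands only at positions 0 and 12 of \<open>gen_vector\<close>. Four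
  indices from 1 to 4 with sum minus 4 equal to 0 or 12 must all be 1 or all be 4.\<close>

lemma hankel_eq_hankel_0:
  assumes "i \<in> {1..4}" "j \<in> {1..4}" "k \<in> {1..4}" "l \<in> {1..4}"
  shows "hankel v0 P i j k l = hankel 0 P i j k l
     + (if i = 1 then if j = 1 then if k = 1 then if l = 1 then v0 else 0 else 0 else 0 else 0)
     + (if i = 4 then if j = 4 then if k = 4 then if l = 4 then v0 else 0 else 0 else 0 else 0)"
proof -
  have eq: "{1..4::nat} = {1, 2, 3, 4}"
    by auto
  show ?thesis
    using assms unfolding eq hankel_def hankel_tensor_def gen_vector_def Let_def
    by (elim insertE emptyE) simp_all
qed

lemma tensor_poly_add:
  "tensor_poly (\<lambda>i j k l. A i j k l + B i j k l) x = tensor_poly A x + tensor_poly B x"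
  unfolding tensor_poly_def by (simp only: distrib_right sum.distrib)

text \<open>Of the 256 summands only the one with all indices equal to \<open>a\<close>
  survives.\<close>

lemma tensor_poly_diagonal_unit:
  assumes "a \<in> {1..4}"
  shows "tensor_poly (\<lambda>i j k l.
      if i = a then if j = a then if k = a then if l = a then c else 0 else 0 else 0 else 0) x
    = c * (x $ of_nat a) ^ 4"
proof -
  have "{1..4::nat} = {1, 2, 3, 4}"
    by auto
  then show ?thesis
    using assms unfolding tensor_poly_def by (auto simp: power4_eq_xxxx)
qed

lemma tensor_poly_hankel_eq:
  "tensor_poly (hankel v0 P) x = tensor_poly (hankel 0 P) x + v0 * ((x $ 1) ^ 4 + (x $ 4) ^ 4)"
proof -
  have "tensor_poly (hankel v0 P) x = tensor_poly
      (\<lambda>i j k l. hankel 0 P i j k l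
        + (if i = 1 then if j = 1 then if k = 1 then if l = 1 then v0 else 0 else 0 else 0 else 0)
        + (if i = 4 then if j = 4 then if k = 4 then if l = 4 then v0 else 0 else 0 else 0 else 0)) x"
    \<comment> \<open>Fixing \<open>v0\<close> in the equation keeps it from rewriting the
      \<open>hankel 0 P\<close> that it introduces, so simplification does not loop.\<close>
    unfolding tensor_poly_def by (intro sum.cong refl) (simp only: hankel_eq_hankel_0[of _ _ _ _ v0])
  also have "\<dots> = tensor_poly (hankel 0 P) x + v0 * (x $ of_nat 1) ^ 4 + v0 * (x $ of_nat 4) ^ 4"
    unfolding tensor_poly_add
    by (subst (1 2) tensor_poly_diagonal_unit) simp_all
  finally show ?thesis
    by (simp add: distrib_left)
qed

lemma SOS_imp_PSD: "SOS A \<Longrightarrow> PSD A"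
  unfolding SOS_def PSD_def by (metis sum_nonneg zero_le_power2)

text \<open>Only the coefficients of \<open>x\<^sub>1\<^sup>4\<close> and \<open>x\<^sub>4\<^sup>4\<close> involve \<open>v0\<close>, so at a zero of the
  polynomial for \<open>M\<close> with \<open>(x\<^sub>1, x\<^sub>4) \<noteq> 0\<close> the polynomial for \<open>v0 < M\<close> is negative.\<close>

lemma PSD_hankel_ge:
  assumes "PSD (hankel v0 P)" "tensor_poly (hankel M P) x = 0" "(x $ 1)\<^sup>2 + (x $ 4)\<^sup>2 > 0"
  shows "M \<le> v0"
proof -
  have "x $ 1 \<noteq> 0 \<or> x $ 4 \<noteq> 0"
    using assms(3) by auto
  then have pos: "(x $ 1) ^ 4 + (x $ 4) ^ 4 > 0"
    by (auto intro: add_pos_nonneg add_nonneg_pos simp: zero_less_power_eq)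
  have "0 \<le> tensor_poly (hankel v0 P) x - tensor_poly (hankel M P) x"
    using assms(1,2) by (simp add: PSD_def)
  \<comment> \<open>The common part \<open>tensor_poly (hankel 0 P) x\<close> cancels.\<close>
  also have "\<dots> = (v0 - M) * ((x $ 1) ^ 4 + (x $ 4) ^ 4)"
    unfolding tensor_poly_hankel_eq[of v0] tensor_poly_hankel_eq[of M] by (simp add: algebra_simps)
  finally show ?thesis
    using pos by (simp add: zero_le_mult_iff)
qed

theorem theorem6:
  fixes P :: "real ^ 5" and M :: real and xbar :: "real ^ 4"
  assumes "eta (P $ 5) (P $ 2) < 1"
    and "(xbar $ 1)\<^sup>2 + (xbar $ 4)\<^sup>2 > 0"
    and "SOS (hankel M P)"
    and "tensor_poly (hankel M P) xbar = 0"
  shows "PNS_free P"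
proof -
  \<comment> \<open>\<open>M\<close> is admissible by assumption; any other SOS value is also a PSD
    value, hence at least \<open>M\<close>.\<close>
  have "M0 P = M"
    unfolding M0_def using assms by (intro Least_equality) (auto intro: PSD_hankel_ge SOS_imp_PSD)
  \<comment> \<open>Here the lower bound applies directly, and \<open>SOS_imp_PSD\<close> makes
    \<open>M\<close> itself admissible.\<close>
  moreover have "N0 P = M"
    unfolding N0_def using assms by (intro Least_equality) (auto intro: PSD_hankel_ge SOS_imp_PSD)
  ultimately show ?thesis
    by (simp add: PNS_free_def)
qed

end
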